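(* Let $\{E_\lambda:\lambda\in\Lambda\}$ be a family of real Banach spaces each of which is a GL-space, and let $E=[\bigoplus_{\lambda\in\Lambda}E_\lambda]_{l_\infty}$. Then $E$ is a GL-space.
   Context: All spaces are over the real field. $B_E$, $S_E$, $E^*$ denote the closed unit ball, the unit sphere and the dual of $E$. $[\bigoplus_{\lambda\in\Lambda}E_\lambda]_{l_\infty}$ is the $l_\infty$-sum: bounded families $(x_\lambda)$ with $x_\lambda\in E_\lambda$ and norm $\sup_\lambda\|x_\lambda\|$. A Banach space $E$ is a GL-space (generalized-lush space) if for every $x\in S_E$ and every $\varepsilon>0$ there is $x^*\in S_{E^*}$ such that, with $S=S(x^*,\varepsilon)=\{z\in B_E: x^*(z)>1-\varepsilon\}$, one has $x\in S$ and $\mathrm{dist}(y,S)+\mathrm{dist}(y,-S)<2+\varepsilon$ for all $y\in S_E$. *)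

theory Defs
  imports Complex_Main "HOL-Algebra.Module"
begin

section \<open>Real Banach spaces as structures\<close>

text \<open>
  The members of a family of Banach spaces are different objects, so spaces are records with an
  explicit carrier rather than types. The vector space part is a module, in the sense of
  HOL-Algebra, over the field of real numbers. The fields \<^term>\<open>mult\<close> and \<^term>\<open>one\<close> that a
  module record inherits from rings play no role.
\<close>

definition real_ring :: "real ring" where
  "real_ring = \<lparr>carrier = UNIV, mult = (*), one = 1, zero = 0, add = (+)\<rparr>"

record 'a nspace = "(real, 'a) module" +
  nrm :: "'a \<Rightarrow> real" (\<open>\<parallel>_\<parallel>\<index>\<close>)

locale real_normed_space = module real_ring E for E (structure) +
  assumes nrm_eq_0_iff: "x \<in> carrier E \<Longrightarrow> \<parallel>x\<parallel> = 0 \<longleftrightarrow> x = \<zero>\<^bsub>E\<^esub>"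
    and nrm_smult: "x \<in> carrier E \<Longrightarrow> \<parallel>a \<odot>\<^bsub>E\<^esub> x\<parallel> = \<bar>a\<bar> * \<parallel>x\<parallel>"
    and nrm_triangle: "x \<in> carrier E \<Longrightarrow> y \<in> carrier E \<Longrightarrow> \<parallel>x \<oplus>\<^bsub>E\<^esub> y\<parallel> \<le> \<parallel>x\<parallel> + \<parallel>y\<parallel>"

locale real_banach_space = real_normed_space E for E (structure) +
  assumes complete:
    "(\<And>n. s n \<in> carrier E) \<Longrightarrow>
     (\<And>e. e > 0 \<Longrightarrow> \<exists>N. \<forall>m\<ge>N. \<forall>n\<ge>N. \<parallel>s m \<ominus>\<^bsub>E\<^esub> s n\<parallel> < e) \<Longrightarrow>
     \<exists>l\<in>carrier E. (\<lambda>n::nat. \<parallel>s n \<ominus>\<^bsub>E\<^esub> l\<parallel>) \<longlonglongrightarrow> 0"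

definition unit_ball :: "('a, 'm) nspace_scheme \<Rightarrow> 'a set" where
  "unit_ball E = {x \<in> carrier E. \<parallel>x\<parallel>\<^bsub>E\<^esub> \<le> 1}"

definition unit_sphere :: "('a, 'm) nspace_scheme \<Rightarrow> 'a set" where
  "unit_sphere E = {x \<in> carrier E. \<parallel>x\<parallel>\<^bsub>E\<^esub> = 1}"

text \<open>Only the values of a functional on the carrier matter.\<close>

definition dual :: "('a, 'm) nspace_scheme \<Rightarrow> ('a \<Rightarrow> real) set" where
  "dual E = {f.
     (\<forall>x\<in>carrier E. \<forall>y\<in>carrier E. f (x \<oplus>\<^bsub>E\<^esub> y) = f x + f y) \<and>
     (\<forall>a. \<forall>x\<in>carrier E. f (a \<odot>\<^bsub>E\<^esub> x) = a * f x) \<and>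
     (\<exists>K. \<forall>x\<in>carrier E. \<bar>f x\<bar> \<le> K * \<parallel>x\<parallel>\<^bsub>E\<^esub>)}"

definition dual_norm :: "('a, 'm) nspace_scheme \<Rightarrow> ('a \<Rightarrow> real) \<Rightarrow> real" where
  "dual_norm E f = (SUP x\<in>unit_ball E. \<bar>f x\<bar>)"

definition dual_sphere :: "('a, 'm) nspace_scheme \<Rightarrow> ('a \<Rightarrow> real) set" where
  "dual_sphere E = {f \<in> dual E. dual_norm E f = 1}"

section \<open>Generalized-lush spaces\<close>

definition slice :: "('a, 'm) nspace_scheme \<Rightarrow> ('a \<Rightarrow> real) \<Rightarrow> real \<Rightarrow> 'a set" where
  "slice E f e = {z \<in> unit_ball E. f z > 1 - e}"

definition neg_set :: "('a, 'm) nspace_scheme \<Rightarrow> 'a set \<Rightarrow> 'a set" where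
  "neg_set E A = (\<lambda>z. \<ominus>\<^bsub>E\<^esub> z) ` A"

text \<open>
  The distance is meaningful for nonempty \<open>A\<close> only. In the definition of a GL-space below it is
  applied to a slice containing \<open>x\<close> and to its negative.
\<close>

definition set_dist :: "('a, 'm) nspace_scheme \<Rightarrow> 'a \<Rightarrow> 'a set \<Rightarrow> real" where
  "set_dist E y A = (INF z\<in>A. \<parallel>y \<ominus>\<^bsub>E\<^esub> z\<parallel>\<^bsub>E\<^esub>)"

definition GL_space :: "('a, 'm) nspace_scheme \<Rightarrow> bool" where
  "GL_space E \<longleftrightarrow> real_banach_space E \<and>
     (\<forall>x\<in>unit_sphere E. \<forall>e>0. \<exists>f\<in>dual_sphere E.
        x \<in> slice E f e \<and>
        (\<forall>y\<in>unit_sphere E.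
           set_dist E y (slice E f e) + set_dist E y (neg_set E (slice E f e)) < 2 + e))"

section \<open>The sup-norm sum of a family\<close>

text \<open>
  Inserting \<open>0\<close> into the set of norms does not change its supremum, except that the zero space,
  which is the sum of the empty family, correctly gets the norm \<open>0\<close>.
\<close>

definition linf_sum :: "'i set \<Rightarrow> ('i \<Rightarrow> ('a, 'm) nspace_scheme) \<Rightarrow> ('i \<Rightarrow> 'a) nspace" where
  "linf_sum \<Lambda> E = \<lparr>
     carrier = {x \<in> (\<Pi>\<^sub>E i\<in>\<Lambda>. carrier (E i)). bdd_above ((\<lambda>i. \<parallel>x i\<parallel>\<^bsub>E i\<^esub>) ` \<Lambda>)},
     mult = undefined,
     one = undefined,
     zero = (\<lambda>i\<in>\<Lambda>. \<zero>\<^bsub>E i\<^esub>),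
     add = (\<lambda>x y. \<lambda>i\<in>\<Lambda>. x i \<oplus>\<^bsub>E i\<^esub> y i),
     smult = (\<lambda>a x. \<lambda>i\<in>\<Lambda>. a \<odot>\<^bsub>E i\<^esub> x i),
     nrm = (\<lambda>x. Sup (insert 0 ((\<lambda>i. \<parallel>x i\<parallel>\<^bsub>E i\<^esub>) ` \<Lambda>)))\<rparr>"

end

theory Submission
  imports Defs
begin

text \<open>
  Given \<open>x\<close> in the unit sphere of the sum, choose a coordinate \<open>i\<close> in which \<open>x\<close> has almost
  full norm, and pull back the functional \<open>f\<close> that the GL-property of \<open>E i\<close> provides for the
  normalisation of \<open>x i\<close>. Replacing only the \<open>i\<close>-th coordinate of \<open>y\<close> shows that \<open>y\<close> is no
  farther from the slice of the pulled-back functional than \<open>y i\<close> is from the slice of \<open>f\<close>.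
  Now \<open>y i\<close> lies only in the unit ball, but the inequality defining a GL-space passes from the
  sphere to the ball: if \<open>v = t w\<close> with \<open>0 \<le> t \<le> 1\<close>, then
  \<open>\<parallel>v - s\<parallel> \<le> t \<parallel>w - s\<parallel> + (1 - t)\<close> for every \<open>s\<close> in the ball.
\<close>

section \<open>Normed spaces\<close>

lemma real_ring_simps [simp]:
  "carrier real_ring = UNIV" "mult real_ring = (*)" "one real_ring = 1"
  "zero real_ring = 0" "add real_ring = (+)"
  by (simp_all add: real_ring_def)

lemma cring_real_ring: "cring real_ring"
proof (rule cringI)
  show "abelian_group real_ring"
  proof (rule abelian_groupI)
    fix x assume "x \<in> carrier real_ring"
    show "\<exists>y\<in>carrier real_ring. y \<oplus>\<^bsub>real_ring\<^esub> x = \<zero>\<^bsub>real_ring\<^esub>"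
      by (rule bexI[of _ "- x"]) auto
  qed auto
  show "comm_monoid real_ring"
    by (rule comm_monoidI) auto
qed (auto simp: algebra_simps)

text \<open>Module facts such as \<open>smult_l_minus\<close> speak of the additive inverse of the
  scalar ring; this identifies it with ordinary negation.\<close>

lemma a_inv_real_ring [simp]: "\<ominus>\<^bsub>real_ring\<^esub> a = - a"
proof -
  interpret cring real_ring by (rule cring_real_ring)
  show ?thesis
    by (rule minus_equality) auto
qed

context real_normed_space
begin

lemma smult_minus_one: "x \<in> carrier E \<Longrightarrow> (- 1) \<odot> x = \<ominus> x"
  using smult_l_minus[of 1 x] smult_one[of x] by simp

lemma smult_zero_left: "x \<in> carrier E \<Longrightarrow> 0 \<odot> x = \<zero>"
  using smult_l_null[of x] by simp

lemma smult_real_closed [simp]: "x \<in> carrier E \<Longrightarrow> a \<odot> x \<in> carrier E"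
  using smult_closed[of a x] by simp

lemma smult_real_assoc: "x \<in> carrier E \<Longrightarrow> (a * b) \<odot> x = a \<odot> (b \<odot> x)"
  using smult_assoc1[of a b x] by simp

lemma smult_real_add: "x \<in> carrier E \<Longrightarrow> (a + b) \<odot> x = a \<odot> x \<oplus> b \<odot> x"
  using smult_l_distr[of a b x] by simp

lemma smult_real_one: "x \<in> carrier E \<Longrightarrow> 1 \<odot> x = x"
  using smult_one[of x] by simp

lemma smult_diff: "x \<in> carrier E \<Longrightarrow> y \<in> carrier E \<Longrightarrow> a \<odot> (x \<ominus> y) = a \<odot> x \<ominus> a \<odot> y"
  using smult_r_distr[of a x "\<ominus> y"] smult_r_minus[of a y] by (simp add: a_minus_def)

lemma nrm_zero [simp]: "\<parallel>\<zero>\<parallel> = 0"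
  using nrm_eq_0_iff by simp

lemma nrm_neg [simp]: "x \<in> carrier E \<Longrightarrow> \<parallel>\<ominus> x\<parallel> = \<parallel>x\<parallel>"
  using nrm_smult[of x "- 1"] by (simp add: smult_minus_one)

text \<open>Follows from the other axioms:
  \<open>0 = \<parallel>x \<oplus> (\<ominus> x)\<parallel>\<close> is at most twice
  \<open>\<parallel>x\<parallel>\<close>.\<close>

lemma nrm_nonneg [simp]: "x \<in> carrier E \<Longrightarrow> 0 \<le> \<parallel>x\<parallel>"
  using nrm_triangle[of x "\<ominus> x"] by (simp add: r_neg)

lemma nrm_diff_le:
  assumes "x \<in> carrier E" "y \<in> carrier E"
  shows "\<parallel>x \<ominus> y\<parallel> \<le> \<parallel>x\<parallel> + \<parallel>y\<parallel>"
  using nrm_triangle[of x "\<ominus> y"] assms by (simp add: a_minus_def)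

lemma nrm_diff_triangle:
  assumes "x \<in> carrier E" "y \<in> carrier E" "z \<in> carrier E"
  shows "\<parallel>x \<ominus> z\<parallel> \<le> \<parallel>x \<ominus> y\<parallel> + \<parallel>y \<ominus> z\<parallel>"
proof -
  have "(x \<ominus> y) \<oplus> (y \<ominus> z) = x \<ominus> z"
    using assms by (simp add: a_minus_def a_ac r_neg1 r_neg2)
  then show ?thesis
    using nrm_triangle[of "x \<ominus> y" "y \<ominus> z"] assms by simp
qed

section \<open>Distance to a set\<close>

lemma set_dist_lower:
  assumes "A \<subseteq> carrier E" "y \<in> carrier E" "a \<in> A"
  shows "set_dist E y A \<le> \<parallel>y \<ominus> a\<parallel>"
  unfolding set_dist_def
proof (rule cINF_lower[OF _ \<open>a \<in> A\<close>])
  show "bdd_below ((\<lambda>z. \<parallel>y \<ominus> z\<parallel>) ` A)"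
    using assms by (intro bdd_belowI2[of _ 0]) auto
qed

lemma set_dist_greatest:
  assumes "A \<noteq> {}" "\<And>a. a \<in> A \<Longrightarrow> c \<le> \<parallel>y \<ominus> a\<parallel>"
  shows "c \<le> set_dist E y A"
  unfolding set_dist_def using assms by (rule cINF_greatest)

text \<open>The vectors \<open>y \<ominus> (\<ominus> z)\<close> and
  \<open>(\<ominus> y) \<ominus> z\<close> are negatives of each other, so their norms agree.
  Reflecting the point instead of the slice means that only one slice has to be handled
  later.\<close>

lemma set_dist_neg_set:
  assumes "A \<subseteq> carrier E" "y \<in> carrier E"
  shows "set_dist E y (neg_set E A) = set_dist E (\<ominus> y) A"
proof -
  have "\<parallel>y \<ominus> (\<ominus> z)\<parallel> = \<parallel>(\<ominus> y) \<ominus> z\<parallel>" if "z \<in> A" for z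
  proof -
    have z: "z \<in> carrier E" using that assms by auto
    then have "\<ominus> (y \<ominus> (\<ominus> z)) = (\<ominus> y) \<ominus> z"
      using assms by (simp add: a_minus_def minus_add)
    then show ?thesis
      using nrm_neg[of "y \<ominus> (\<ominus> z)"] assms z by simp
  qed
  then show ?thesis
    unfolding set_dist_def neg_set_def image_image by (metis (no_types, lifting) INF_cong)
qed

section \<open>Slices and the passage from the sphere to the ball\<close>

lemma slice_subset_carrier: "slice E f e \<subseteq> carrier E"
  by (auto simp: slice_def unit_ball_def)

lemma unit_ball_neg: "y \<in> unit_ball E \<Longrightarrow> \<ominus> y \<in> unit_ball E"
  by (simp add: unit_ball_def)

lemma normalize_unit_sphere:
  assumes "v \<in> carrier E" "\<parallel>v\<parallel> \<noteq> 0"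
  shows "(1 / \<parallel>v\<parallel>) \<odot> v \<in> unit_sphere E" "v = \<parallel>v\<parallel> \<odot> ((1 / \<parallel>v\<parallel>) \<odot> v)"
  using assms by (simp_all add: unit_sphere_def nrm_smult smult_real_one flip: smult_real_assoc)

text \<open>A nonzero \<open>v\<close> is its norm times its normalisation. The zero vector has no
  direction of its own, so an arbitrary point of the nonempty sphere is taken with
  \<open>t = 0\<close>.\<close>

lemma unit_ball_scaled_sphere:
  assumes "unit_sphere E \<noteq> {}" "v \<in> unit_ball E"
  obtains t w where "0 \<le> t" "t \<le> 1" "w \<in> unit_sphere E" "v = t \<odot> w"
proof (cases "\<parallel>v\<parallel> = 0")
  case True
  obtain u where u: "u \<in> unit_sphere E" using assms by auto
  have "v = 0 \<odot> u"
    using u True assms nrm_eq_0_iff[of v]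
    by (simp add: unit_ball_def unit_sphere_def smult_zero_left)
  then show ?thesis using that[of 0 u] u by simp
next
  case False
  then show ?thesis
    using that[of "\<parallel>v\<parallel>" "(1 / \<parallel>v\<parallel>) \<odot> v"] assms normalize_unit_sphere[of v]
    by (simp add: unit_ball_def)
qed

lemma set_dist_smult_le:
  assumes A: "A \<subseteq> unit_ball E" "A \<noteq> {}" and w: "w \<in> carrier E" and t: "0 \<le> t" "t \<le> 1"
  shows "set_dist E (t \<odot> w) A \<le> t * set_dist E w A + (1 - t)"
proof -
  have Ac: "A \<subseteq> carrier E" using A by (auto simp: unit_ball_def)
  have bd: "set_dist E (t \<odot> w) A \<le> t * \<parallel>w \<ominus> s\<parallel> + (1 - t)" if "s \<in> A" for s
  proof -
    have s: "s \<in> carrier E" "\<parallel>s\<parallel> \<le> 1" using that A by (auto simp: unit_ball_def)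
    have "set_dist E (t \<odot> w) A \<le> \<parallel>t \<odot> w \<ominus> s\<parallel>"
      using Ac w that by (intro set_dist_lower) auto
    \<comment> \<open>The intermediate point \<open>t \<odot> s\<close> separates a scaled copy of
      \<open>w \<ominus> s\<close> from an error of norm at most \<open>1 - t\<close>.\<close>
    also have "\<dots> \<le> \<parallel>t \<odot> w \<ominus> t \<odot> s\<parallel> + \<parallel>t \<odot> s \<ominus> s\<parallel>"
      using w s by (intro nrm_diff_triangle) auto
    also have "\<parallel>t \<odot> w \<ominus> t \<odot> s\<parallel> = t * \<parallel>w \<ominus> s\<parallel>"
      using w s t smult_diff[of w s t] nrm_smult[of "w \<ominus> s" t] by simp
    also have "t \<odot> s \<ominus> s = (t - 1) \<odot> s"
      using s smult_real_add[of s t "- 1"] by (simp add: smult_minus_one a_minus_def)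
    also have "\<parallel>(t - 1) \<odot> s\<parallel> \<le> 1 - t"
      using s t by (simp add: nrm_smult mult_left_le)
    finally show ?thesis by simp
  qed
  \<comment> \<open>For \<open>t > 0\<close>, solving \<open>bd\<close> for the norm of
    \<open>w \<ominus> s\<close> allows the infimum over \<open>s\<close> to be taken. For
    \<open>t = 0\<close>, one element of \<open>A\<close> is enough.\<close>
  show ?thesis
  proof (cases "t = 0")
    case True
    then show ?thesis using bd A by fastforce
  next
    case False
    then have "(set_dist E (t \<odot> w) A - (1 - t)) / t \<le> set_dist E w A"
      using t bd A by (intro set_dist_greatest) (auto simp: field_simps)
    then show ?thesis using False t by (simp add: field_simps)
  qed
qed

end

text \<open>The form of the GL-property used for a coordinate space: a coordinate of a unit vector
  of the sum need not have norm one, so the test points must range over the ball.\<close>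

lemma GL_space_unit_ball:
  assumes GL: "GL_space E" and x: "x \<in> unit_sphere E" and e: "e > 0"
  obtains f where "f \<in> dual_sphere E" "x \<in> slice E f e"
    "\<And>y. y \<in> unit_ball E \<Longrightarrow>
      set_dist E y (slice E f e) + set_dist E (\<ominus>\<^bsub>E\<^esub> y) (slice E f e) < 2 + e"
proof -
  interpret real_banach_space E using GL by (simp add: GL_space_def)
  obtain f where f: "f \<in> dual_sphere E" "x \<in> slice E f e"
    and sph: "\<And>y. y \<in> unit_sphere E \<Longrightarrow>
      set_dist E y (slice E f e) + set_dist E y (neg_set E (slice E f e)) < 2 + e"
    using GL x e unfolding GL_space_def by blast
  let ?S = "slice E f e"
  have S: "?S \<subseteq> unit_ball E" "?S \<noteq> {}" using f by (auto simp: slice_def)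
  show thesis
  proof (rule that[OF f])
    fix y assume "y \<in> unit_ball E"
    then obtain t w where t: "0 \<le> t" "t \<le> 1" and w: "w \<in> unit_sphere E" and y: "y = t \<odot>\<^bsub>E\<^esub> w"
      using unit_ball_scaled_sphere x by blast
    have wc: "w \<in> carrier E" using w by (simp add: unit_sphere_def)
    have neg: "\<ominus>\<^bsub>E\<^esub> y = t \<odot>\<^bsub>E\<^esub> (\<ominus>\<^bsub>E\<^esub> w)"
      using y wc smult_r_minus[of t w] by simp
    have "set_dist E y ?S + set_dist E (\<ominus>\<^bsub>E\<^esub> y) ?S
        \<le> t * (set_dist E w ?S + set_dist E (\<ominus>\<^bsub>E\<^esub> w) ?S) + 2 * (1 - t)"
      unfolding neg unfolding y
      using set_dist_smult_le[OF S wc t] set_dist_smult_le[OF S _ t, of "\<ominus>\<^bsub>E\<^esub> w"] wc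
      by (simp add: algebra_simps)
    \<comment> \<open>For \<open>t > 0\<close> the sphere inequality bounds the left side strictly
      by \<open>t * (2 + e) + 2 * (1 - t) = 2 + t * e\<close>. For \<open>t = 0\<close> the left
      side is \<open>2\<close>, and strictness comes from \<open>e > 0\<close>.\<close>
    also have "\<dots> < 2 + e"
    proof (cases "t = 0")
      case False
      have "set_dist E w ?S + set_dist E (\<ominus>\<^bsub>E\<^esub> w) ?S < 2 + e"
        using sph[OF w] set_dist_neg_set[OF slice_subset_carrier wc] by simp
      then have "t * (set_dist E w ?S + set_dist E (\<ominus>\<^bsub>E\<^esub> w) ?S) < t * (2 + e)"
        using False t by simp
      moreover have "t * e \<le> e" using t e by simp
      ultimately show ?thesis by (simp add: algebra_simps)
    qed (use e in simp)
    finally show "set_dist E y ?S + set_dist E (\<ominus>\<^bsub>E\<^esub> y) ?S < 2 + e" .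
  qed
qed

section \<open>The sup-norm sum\<close>

lemma linf_sum_simps:
  "zero (linf_sum \<Lambda> E) = (\<lambda>i\<in>\<Lambda>. \<zero>\<^bsub>E i\<^esub>)"
  "add (linf_sum \<Lambda> E) x y = (\<lambda>i\<in>\<Lambda>. x i \<oplus>\<^bsub>E i\<^esub> y i)"
  "smult (linf_sum \<Lambda> E) a x = (\<lambda>i\<in>\<Lambda>. a \<odot>\<^bsub>E i\<^esub> x i)"
  by (simp_all add: linf_sum_def)

lemma linf_sum_carrierI:
  assumes "\<And>i. i \<in> \<Lambda> \<Longrightarrow> x i \<in> carrier (E i)" "x \<in> extensional \<Lambda>"
    and "\<And>i. i \<in> \<Lambda> \<Longrightarrow> \<parallel>x i\<parallel>\<^bsub>E i\<^esub> \<le> K"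
  shows "x \<in> carrier (linf_sum \<Lambda> E)"
  using assms by (auto simp: linf_sum_def PiE_def intro!: bdd_aboveI2)

lemma linf_sum_coord:
  "x \<in> carrier (linf_sum \<Lambda> E) \<Longrightarrow> i \<in> \<Lambda> \<Longrightarrow> x i \<in> carrier (E i)"
  by (auto simp: linf_sum_def)

lemma linf_sum_extensional: "x \<in> carrier (linf_sum \<Lambda> E) \<Longrightarrow> x \<in> extensional \<Lambda>"
  by (auto simp: linf_sum_def PiE_def)

lemma linf_sum_coord_le:
  assumes "x \<in> carrier (linf_sum \<Lambda> E)" "i \<in> \<Lambda>"
  shows "\<parallel>x i\<parallel>\<^bsub>E i\<^esub> \<le> \<parallel>x\<parallel>\<^bsub>linf_sum \<Lambda> E\<^esub>"
  using assms by (auto simp: linf_sum_def intro!: cSup_upper)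

text \<open>The bound must also dominate the \<open>0\<close> inserted into the supremum, hence
  \<open>0 \<le> K\<close>.\<close>

lemma linf_sum_nrm_le:
  assumes "\<And>i. i \<in> \<Lambda> \<Longrightarrow> \<parallel>x i\<parallel>\<^bsub>E i\<^esub> \<le> K" "0 \<le> K"
  shows "\<parallel>x\<parallel>\<^bsub>linf_sum \<Lambda> E\<^esub> \<le> K"
  using assms by (auto simp: linf_sum_def intro!: cSup_least)

lemma linf_sum_nrm_nonneg:
  assumes "x \<in> carrier (linf_sum \<Lambda> E)"
  shows "0 \<le> \<parallel>x\<parallel>\<^bsub>linf_sum \<Lambda> E\<^esub>"
  using assms by (auto simp: linf_sum_def intro!: cSup_upper)

locale normed_family =
  fixes \<Lambda> :: "'i set" and E :: "'i \<Rightarrow> ('a, 'm) nspace_scheme"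
  assumes family: "i \<in> \<Lambda> \<Longrightarrow> real_normed_space (E i)"
begin

abbreviation L where "L \<equiv> linf_sum \<Lambda> E"

lemma family_module: "i \<in> \<Lambda> \<Longrightarrow> module real_ring (E i)"
  using family by (rule real_normed_space.axioms)

lemma family_abelian_group: "i \<in> \<Lambda> \<Longrightarrow> abelian_group (E i)"
  using family_module by (rule module.axioms)

lemma family_abelian_monoid: "i \<in> \<Lambda> \<Longrightarrow> abelian_monoid (E i)"
  using family_abelian_group by (rule abelian_group.axioms)

section \<open>The sum as a real vector space\<close>

lemma add_closed:
  assumes "x \<in> carrier L" "y \<in> carrier L"
  shows "x \<oplus>\<^bsub>L\<^esub> y \<in> carrier L"
proof (rule linf_sum_carrierI)
  fix i assume i: "i \<in> \<Lambda>"
  interpret N: real_normed_space "E i" using family i .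
  note c = linf_sum_coord[OF assms(1) i] linf_sum_coord[OF assms(2) i]
  show "(x \<oplus>\<^bsub>L\<^esub> y) i \<in> carrier (E i)"
    using i c by (simp add: linf_sum_simps)
  show "\<parallel>(x \<oplus>\<^bsub>L\<^esub> y) i\<parallel>\<^bsub>E i\<^esub> \<le> \<parallel>x\<parallel>\<^bsub>L\<^esub> + \<parallel>y\<parallel>\<^bsub>L\<^esub>"
    using i N.nrm_triangle[OF c] linf_sum_coord_le[OF assms(1) i] linf_sum_coord_le[OF assms(2) i]
    by (simp add: linf_sum_simps)
qed (simp add: linf_sum_simps)

lemma zero_closed: "\<zero>\<^bsub>L\<^esub> \<in> carrier L"
proof (rule linf_sum_carrierI)
  fix i assume i: "i \<in> \<Lambda>"
  interpret N: real_normed_space "E i" using family i .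
  show "\<zero>\<^bsub>L\<^esub> i \<in> carrier (E i)" "\<parallel>\<zero>\<^bsub>L\<^esub> i\<parallel>\<^bsub>E i\<^esub> \<le> 0"
    using i by (simp_all add: linf_sum_simps)
qed (simp add: linf_sum_simps)

lemma smult_closed:
  assumes "x \<in> carrier L"
  shows "a \<odot>\<^bsub>L\<^esub> x \<in> carrier L"
proof (rule linf_sum_carrierI)
  fix i assume i: "i \<in> \<Lambda>"
  interpret N: real_normed_space "E i" using family i .
  note c = linf_sum_coord[OF assms(1) i]
  show "(a \<odot>\<^bsub>L\<^esub> x) i \<in> carrier (E i)"
    using i c by (simp add: linf_sum_simps)
  show "\<parallel>(a \<odot>\<^bsub>L\<^esub> x) i\<parallel>\<^bsub>E i\<^esub> \<le> \<bar>a\<bar> * \<parallel>x\<parallel>\<^bsub>L\<^esub>"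
    using i c linf_sum_coord_le[OF assms(1) i]
    by (simp add: linf_sum_simps N.nrm_smult mult_left_mono)
qed (simp add: linf_sum_simps)

text \<open>Members of the carrier are extensional on \<open>\<Lambda>\<close>, so each identity can
  be checked coordinate by coordinate.\<close>

lemma abelian_group_L: "abelian_group L"
proof (rule abelian_groupI)
  fix x y z assume c: "x \<in> carrier L" "y \<in> carrier L" "z \<in> carrier L"
  show "x \<oplus>\<^bsub>L\<^esub> y \<oplus>\<^bsub>L\<^esub> z = x \<oplus>\<^bsub>L\<^esub> (y \<oplus>\<^bsub>L\<^esub> z)"
    using c by (intro extensionalityI[of _ \<Lambda>])
      (auto simp: linf_sum_simps linf_sum_coord
        abelian_monoid.a_assoc[OF family_abelian_monoid])
next
  fix x y assume c: "x \<in> carrier L" "y \<in> carrier L"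
  show "x \<oplus>\<^bsub>L\<^esub> y = y \<oplus>\<^bsub>L\<^esub> x"
    using c by (intro extensionalityI[of _ \<Lambda>])
      (auto simp: linf_sum_simps linf_sum_coord
        abelian_monoid.a_comm[OF family_abelian_monoid])
next
  fix x assume c: "x \<in> carrier L"
  show "\<zero>\<^bsub>L\<^esub> \<oplus>\<^bsub>L\<^esub> x = x"
    using c by (intro extensionalityI[of _ \<Lambda>])
      (auto simp: linf_sum_simps linf_sum_coord linf_sum_extensional
        abelian_monoid.l_zero[OF family_abelian_monoid])
  \<comment> \<open>The multiple by \<open>-1\<close> serves as the inverse, because
    \<open>smult_closed\<close> already places it in the carrier.\<close>
  have "((- 1) \<odot>\<^bsub>L\<^esub> x) \<oplus>\<^bsub>L\<^esub> x = \<zero>\<^bsub>L\<^esub>"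
    using c by (intro extensionalityI[of _ \<Lambda>])
      (auto simp: linf_sum_simps linf_sum_coord abelian_group.l_neg[OF family_abelian_group]
        real_normed_space.smult_minus_one[OF family])
  then show "\<exists>y\<in>carrier L. y \<oplus>\<^bsub>L\<^esub> x = \<zero>\<^bsub>L\<^esub>"
    using smult_closed[OF c] by blast
qed (auto intro: add_closed zero_closed)

lemma module_L: "module real_ring L"
proof (rule moduleI)
  fix a b x assume c: "x \<in> carrier L"
  show "(a \<oplus>\<^bsub>real_ring\<^esub> b) \<odot>\<^bsub>L\<^esub> x = a \<odot>\<^bsub>L\<^esub> x \<oplus>\<^bsub>L\<^esub> b \<odot>\<^bsub>L\<^esub> x"
    using c by (intro extensionalityI[of _ \<Lambda>])
      (auto simp: linf_sum_simps linf_sum_coord real_normed_space.smult_real_add[OF family])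
  show "(a \<otimes>\<^bsub>real_ring\<^esub> b) \<odot>\<^bsub>L\<^esub> x = a \<odot>\<^bsub>L\<^esub> (b \<odot>\<^bsub>L\<^esub> x)"
    using c by (intro extensionalityI[of _ \<Lambda>])
      (auto simp: linf_sum_simps linf_sum_coord real_normed_space.smult_real_assoc[OF family])
  show "\<one>\<^bsub>real_ring\<^esub> \<odot>\<^bsub>L\<^esub> x = x"
    using c by (intro extensionalityI[of _ \<Lambda>])
      (auto simp: linf_sum_simps linf_sum_coord linf_sum_extensional
        real_normed_space.smult_real_one[OF family])
next
  fix a x y assume c: "x \<in> carrier L" "y \<in> carrier L"
  show "a \<odot>\<^bsub>L\<^esub> (x \<oplus>\<^bsub>L\<^esub> y) = a \<odot>\<^bsub>L\<^esub> x \<oplus>\<^bsub>L\<^esub> a \<odot>\<^bsub>L\<^esub> y"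
    using c by (intro extensionalityI[of _ \<Lambda>])
      (auto simp: linf_sum_simps linf_sum_coord module.smult_r_distr[OF family_module])
qed (auto intro: cring_real_ring abelian_group_L smult_closed)

section \<open>The supremum as a norm\<close>

lemma real_normed_space_L: "real_normed_space L"
proof (intro real_normed_space.intro module_L real_normed_space_axioms.intro)
  fix x assume c: "x \<in> carrier L"
  show "\<parallel>x\<parallel>\<^bsub>L\<^esub> = 0 \<longleftrightarrow> x = \<zero>\<^bsub>L\<^esub>"
  proof
    assume 0: "\<parallel>x\<parallel>\<^bsub>L\<^esub> = 0"
    show "x = \<zero>\<^bsub>L\<^esub>"
    proof (rule extensionalityI)
      fix i assume i: "i \<in> \<Lambda>"
      interpret N: real_normed_space "E i" using family i .
      have "\<parallel>x i\<parallel>\<^bsub>E i\<^esub> = 0"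
        using linf_sum_coord_le[OF c i] 0 N.nrm_nonneg[OF linf_sum_coord[OF c i]] by simp
      then show "x i = \<zero>\<^bsub>L\<^esub> i"
        using N.nrm_eq_0_iff[OF linf_sum_coord[OF c i]] i by (simp add: linf_sum_simps)
    qed (use c in \<open>auto simp: linf_sum_extensional linf_sum_simps\<close>)
  next
    assume "x = \<zero>\<^bsub>L\<^esub>"
    then have "\<parallel>x\<parallel>\<^bsub>L\<^esub> \<le> 0"
      by (intro linf_sum_nrm_le)
        (auto simp: linf_sum_simps real_normed_space.nrm_zero[OF family])
    then show "\<parallel>x\<parallel>\<^bsub>L\<^esub> = 0" using linf_sum_nrm_nonneg[OF c] by simp
  qed
  fix a
  \<comment> \<open>One inequality suffices for homogeneity: applied to the scalar
    \<open>1 / a\<close> and the vector \<open>a \<odot> x\<close>, it yields the reverse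
    one.\<close>
  have le: "\<parallel>b \<odot>\<^bsub>L\<^esub> y\<parallel>\<^bsub>L\<^esub> \<le> \<bar>b\<bar> * \<parallel>y\<parallel>\<^bsub>L\<^esub>" if y: "y \<in> carrier L" for b y
    using y by (intro linf_sum_nrm_le mult_nonneg_nonneg linf_sum_nrm_nonneg)
      (auto simp: linf_sum_simps real_normed_space.nrm_smult[OF family] linf_sum_coord
        linf_sum_coord_le mult_left_mono)
  show "\<parallel>a \<odot>\<^bsub>L\<^esub> x\<parallel>\<^bsub>L\<^esub> = \<bar>a\<bar> * \<parallel>x\<parallel>\<^bsub>L\<^esub>"
  proof (cases "a = 0")
    case True
    then show ?thesis
      using le[OF c, of a] linf_sum_nrm_nonneg[OF smult_closed[OF c, of a]] by simp
  next
    case False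
    then have "(1 / a) \<odot>\<^bsub>L\<^esub> (a \<odot>\<^bsub>L\<^esub> x) = x"
      using module.smult_assoc1[OF module_L, of "1 / a" a x]
        module.smult_one[OF module_L c] c by simp
    then have "\<parallel>x\<parallel>\<^bsub>L\<^esub> \<le> \<bar>1 / a\<bar> * \<parallel>a \<odot>\<^bsub>L\<^esub> x\<parallel>\<^bsub>L\<^esub>"
      using le[OF smult_closed[OF c, of a], of "1 / a"] by simp
    then have "\<bar>a\<bar> * \<parallel>x\<parallel>\<^bsub>L\<^esub> \<le> \<parallel>a \<odot>\<^bsub>L\<^esub> x\<parallel>\<^bsub>L\<^esub>"
      using False by (simp add: field_simps)
    then show ?thesis using le[OF c, of a] by simp
  qed
next
  fix x y assume c: "x \<in> carrier L" "y \<in> carrier L"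
  show "\<parallel>x \<oplus>\<^bsub>L\<^esub> y\<parallel>\<^bsub>L\<^esub> \<le> \<parallel>x\<parallel>\<^bsub>L\<^esub> + \<parallel>y\<parallel>\<^bsub>L\<^esub>"
  proof (rule linf_sum_nrm_le)
    fix i assume i: "i \<in> \<Lambda>"
    have "\<parallel>x i \<oplus>\<^bsub>E i\<^esub> y i\<parallel>\<^bsub>E i\<^esub> \<le> \<parallel>x i\<parallel>\<^bsub>E i\<^esub> + \<parallel>y i\<parallel>\<^bsub>E i\<^esub>"
      using real_normed_space.nrm_triangle[OF family] i c linf_sum_coord by metis
    then show "\<parallel>(x \<oplus>\<^bsub>L\<^esub> y) i\<parallel>\<^bsub>E i\<^esub> \<le> \<parallel>x\<parallel>\<^bsub>L\<^esub> + \<parallel>y\<parallel>\<^bsub>L\<^esub>"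
      using i linf_sum_coord_le[OF c(1) i] linf_sum_coord_le[OF c(2) i]
      by (simp add: linf_sum_simps)
  qed (use c in \<open>simp add: linf_sum_nrm_nonneg\<close>)
qed

section \<open>Coordinates of differences, and completeness\<close>

sublocale L: real_normed_space L
  by (rule real_normed_space_L)

text \<open>The record stores no negation, so the coordinates of an additive inverse are read off
  from the multiple by \<open>-1\<close>.\<close>

lemma neg_coord:
  assumes "x \<in> carrier L" "i \<in> \<Lambda>"
  shows "(\<ominus>\<^bsub>L\<^esub> x) i = \<ominus>\<^bsub>E i\<^esub> x i"
proof -
  interpret N: real_normed_space "E i" using family assms(2) .
  have "(\<ominus>\<^bsub>L\<^esub> x) i = ((- 1) \<odot>\<^bsub>L\<^esub> x) i"
    by (simp only: L.smult_minus_one[OF assms(1)])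
  then show ?thesis
    using assms N.smult_minus_one[OF linf_sum_coord[OF assms]] by (simp add: linf_sum_simps)
qed

lemma diff_coord:
  assumes "x \<in> carrier L" "y \<in> carrier L" "i \<in> \<Lambda>"
  shows "(x \<ominus>\<^bsub>L\<^esub> y) i = x i \<ominus>\<^bsub>E i\<^esub> y i"
  using assms by (simp add: a_minus_def linf_sum_simps neg_coord)

text \<open>A Cauchy sequence converges in every coordinate, at a rate independent of the
  coordinate. This uniformity, \<open>unif\<close>, gives both the boundedness of the limit and
  convergence in norm.\<close>

lemma real_banach_space_L:
  assumes banach: "\<And>i. i \<in> \<Lambda> \<Longrightarrow> real_banach_space (E i)"
  shows "real_banach_space L"
proof (intro real_banach_space.intro real_normed_space_L real_banach_space_axioms.intro)
  fix s :: "nat \<Rightarrow> _"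
  assume s: "\<And>n. s n \<in> carrier L"
    and Cauchy: "\<And>e. e > 0 \<Longrightarrow> \<exists>N. \<forall>m\<ge>N. \<forall>n\<ge>N. \<parallel>s m \<ominus>\<^bsub>L\<^esub> s n\<parallel>\<^bsub>L\<^esub> < e"
  note sc = linf_sum_coord[OF s]
  have coord: "\<parallel>s m i \<ominus>\<^bsub>E i\<^esub> s n i\<parallel>\<^bsub>E i\<^esub> \<le> \<parallel>s m \<ominus>\<^bsub>L\<^esub> s n\<parallel>\<^bsub>L\<^esub>" if "i \<in> \<Lambda>" for i m n
    using linf_sum_coord_le[of "s m \<ominus>\<^bsub>L\<^esub> s n" \<Lambda> E i] s that by (simp add: diff_coord)
  have "\<exists>l\<in>carrier (E i). (\<lambda>n. \<parallel>s n i \<ominus>\<^bsub>E i\<^esub> l\<parallel>\<^bsub>E i\<^esub>) \<longlonglongrightarrow> 0" if i: "i \<in> \<Lambda>" for i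
  proof (rule real_banach_space.complete[OF banach[OF i]])
    fix e :: real assume "e > 0"
    then show "\<exists>N. \<forall>m\<ge>N. \<forall>n\<ge>N. \<parallel>s m i \<ominus>\<^bsub>E i\<^esub> s n i\<parallel>\<^bsub>E i\<^esub> < e"
      using Cauchy coord[OF i] by (meson le_less_trans)
  qed (rule sc[OF i])
  then obtain l0 where l0: "\<And>i. i \<in> \<Lambda> \<Longrightarrow> l0 i \<in> carrier (E i)"
    "\<And>i. i \<in> \<Lambda> \<Longrightarrow> (\<lambda>n. \<parallel>s n i \<ominus>\<^bsub>E i\<^esub> l0 i\<parallel>\<^bsub>E i\<^esub>) \<longlonglongrightarrow> 0"
    by metis
  \<comment> \<open>Restriction makes the limit extensional, as the carrier requires.\<close>
  define l where "l = restrict l0 \<Lambda>"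
  have l: "l i \<in> carrier (E i)" "(\<lambda>n. \<parallel>s n i \<ominus>\<^bsub>E i\<^esub> l i\<parallel>\<^bsub>E i\<^esub>) \<longlonglongrightarrow> 0" if "i \<in> \<Lambda>" for i
    using l0 that by (simp_all add: l_def)
  have unif: "\<exists>N. \<forall>m\<ge>N. \<forall>i\<in>\<Lambda>. \<parallel>s m i \<ominus>\<^bsub>E i\<^esub> l i\<parallel>\<^bsub>E i\<^esub> \<le> e" if e: "e > 0" for e
  proof -
    obtain N where N: "\<And>m n. m \<ge> N \<Longrightarrow> n \<ge> N \<Longrightarrow> \<parallel>s m \<ominus>\<^bsub>L\<^esub> s n\<parallel>\<^bsub>L\<^esub> < e"
      using Cauchy[OF e] by blast
    have "\<parallel>s m i \<ominus>\<^bsub>E i\<^esub> l i\<parallel>\<^bsub>E i\<^esub> \<le> e" if m: "m \<ge> N" and i: "i \<in> \<Lambda>" for m i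
    proof -
      interpret N: real_normed_space "E i" using family i .
      \<comment> \<open>The triangle inequality through \<open>s n i\<close> bounds the fixed
        distance by this sequence for \<open>n \<ge> N\<close>; letting \<open>n\<close> tend to
        infinity leaves \<open>e\<close>. The index \<open>N\<close> was chosen before
        \<open>i\<close>.\<close>
      have "(\<lambda>n. e + \<parallel>s n i \<ominus>\<^bsub>E i\<^esub> l i\<parallel>\<^bsub>E i\<^esub>) \<longlonglongrightarrow> e + 0"
        using l(2)[OF i] by (intro tendsto_intros)
      moreover have "\<parallel>s m i \<ominus>\<^bsub>E i\<^esub> l i\<parallel>\<^bsub>E i\<^esub> \<le> e + \<parallel>s n i \<ominus>\<^bsub>E i\<^esub> l i\<parallel>\<^bsub>E i\<^esub>" if "n \<ge> N" for n
        using N.nrm_diff_triangle[OF sc[OF i, of m] sc[OF i, of n] l(1)[OF i]]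
          coord[OF i, of m n] N[OF m that] by linarith
      ultimately show ?thesis
        using LIMSEQ_le_const[of _ "e + 0"] by auto
    qed
    then show ?thesis by blast
  qed
  have lL: "l \<in> carrier L"
  proof -
    \<comment> \<open>A single term within \<open>1\<close> of \<open>l\<close> in every coordinate
      bounds all coordinates of \<open>l\<close>.\<close>
    obtain N where N: "\<And>i. i \<in> \<Lambda> \<Longrightarrow> \<parallel>s N i \<ominus>\<^bsub>E i\<^esub> l i\<parallel>\<^bsub>E i\<^esub> \<le> 1"
      using unif[of 1] by auto
    show ?thesis
    proof (rule linf_sum_carrierI)
      fix i assume i: "i \<in> \<Lambda>"
      interpret N: real_normed_space "E i" using family i .
      have "l i = s N i \<ominus>\<^bsub>E i\<^esub> (s N i \<ominus>\<^bsub>E i\<^esub> l i)"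
        using sc[OF i, of N] l(1)[OF i]
        by (simp add: a_minus_def N.minus_add N.r_neg2 N.r_neg1)
      then have "\<parallel>l i\<parallel>\<^bsub>E i\<^esub> \<le> \<parallel>s N i\<parallel>\<^bsub>E i\<^esub> + \<parallel>s N i \<ominus>\<^bsub>E i\<^esub> l i\<parallel>\<^bsub>E i\<^esub>"
        using N.nrm_diff_le[of "s N i" "s N i \<ominus>\<^bsub>E i\<^esub> l i"] sc[OF i, of N] l(1)[OF i] by simp
      then show "\<parallel>l i\<parallel>\<^bsub>E i\<^esub> \<le> \<parallel>s N\<parallel>\<^bsub>L\<^esub> + 1"
        using N[OF i] linf_sum_coord_le[OF s i, of N] by linarith
    qed (auto simp: l l_def l0)
  qed
  have "(\<lambda>n. \<parallel>s n \<ominus>\<^bsub>L\<^esub> l\<parallel>\<^bsub>L\<^esub>) \<longlonglongrightarrow> 0"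
  proof (rule LIMSEQ_I)
    fix r :: real assume r: "r > 0"
    \<comment> \<open>Halving \<open>r\<close> keeps the bound strict after the supremum over the
      coordinates.\<close>
    then obtain N where N: "\<And>m i. m \<ge> N \<Longrightarrow> i \<in> \<Lambda> \<Longrightarrow> \<parallel>s m i \<ominus>\<^bsub>E i\<^esub> l i\<parallel>\<^bsub>E i\<^esub> \<le> r / 2"
      using unif[of "r / 2"] by auto
    have "\<parallel>s n \<ominus>\<^bsub>L\<^esub> l\<parallel>\<^bsub>L\<^esub> \<le> r / 2" if "n \<ge> N" for n
      using N[OF that] s lL r by (intro linf_sum_nrm_le) (auto simp: diff_coord)
    then have "norm (\<parallel>s n \<ominus>\<^bsub>L\<^esub> l\<parallel>\<^bsub>L\<^esub> - 0) < r" if "n \<ge> N" for n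
      using r that s lL by force
    then show "\<exists>N. \<forall>n\<ge>N. norm (\<parallel>s n \<ominus>\<^bsub>L\<^esub> l\<parallel>\<^bsub>L\<^esub> - 0) < r" by blast
  qed
  with lL show "\<exists>l\<in>carrier L. (\<lambda>n. \<parallel>s n \<ominus>\<^bsub>L\<^esub> l\<parallel>\<^bsub>L\<^esub>) \<longlonglongrightarrow> 0" by blast
qed

section \<open>Coordinate projections and pulled-back functionals\<close>

lemma unit_ball_coord:
  assumes "y \<in> unit_ball L" "i \<in> \<Lambda>"
  shows "y i \<in> unit_ball (E i)"
  using assms linf_sum_coord_le[of y \<Lambda> E i] linf_sum_coord[of y \<Lambda> E i]
  by (auto simp: unit_ball_def)

text \<open>The sup norm constrains each coordinate separately. This supplies the points of a
  pulled-back slice that are close to a given \<open>y\<close>.\<close>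

lemma unit_ball_update:
  assumes "y \<in> unit_ball L" "i \<in> \<Lambda>" "v \<in> unit_ball (E i)"
  shows "y(i := v) \<in> unit_ball L"
proof -
  have ball: "(y(i := v)) j \<in> unit_ball (E j)" if "j \<in> \<Lambda>" for j
    using unit_ball_coord[OF assms(1) that] assms(3) by simp
  have "y(i := v) \<in> carrier L"
    using ball assms(1,2)
    by (intro linf_sum_carrierI[where K = 1])
      (auto simp: unit_ball_def extensional_def dest: linf_sum_extensional)
  moreover have "\<parallel>y(i := v)\<parallel>\<^bsub>L\<^esub> \<le> 1"
    using ball by (intro linf_sum_nrm_le) (auto simp: unit_ball_def)
  ultimately show ?thesis by (simp add: unit_ball_def)
qed

text \<open>The norm is preserved because the projection maps the unit ball of \<open>L\<close> onto
  that of \<open>E i\<close>: both suprema run over the same values.\<close>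

lemma coord_dual_sphere:
  assumes f: "f \<in> dual_sphere (E i)" and i: "i \<in> \<Lambda>"
  shows "(\<lambda>z. f (z i)) \<in> dual_sphere L"
proof -
  from f have fd: "f \<in> dual (E i)" by (simp add: dual_sphere_def)
  then obtain K where K: "\<And>x. x \<in> carrier (E i) \<Longrightarrow> \<bar>f x\<bar> \<le> K * \<parallel>x\<parallel>\<^bsub>E i\<^esub>"
    unfolding dual_def by blast
  \<comment> \<open>The constant \<open>K\<close> is not known to be nonnegative; its absolute value
    allows the norm of \<open>z i\<close> to be replaced by the larger norm of
    \<open>z\<close>.\<close>
  have "\<bar>f (z i)\<bar> \<le> \<bar>K\<bar> * \<parallel>z\<parallel>\<^bsub>L\<^esub>" if z: "z \<in> carrier L" for z
  proof -
    interpret N: real_normed_space "E i" using family i .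
    note zi = linf_sum_coord[OF z i]
    have "\<bar>f (z i)\<bar> \<le> K * \<parallel>z i\<parallel>\<^bsub>E i\<^esub>" by (rule K[OF zi])
    also have "\<dots> \<le> \<bar>K\<bar> * \<parallel>z\<parallel>\<^bsub>L\<^esub>"
      using linf_sum_coord_le[OF z i] N.nrm_nonneg[OF zi] by (intro mult_mono) auto
    finally show ?thesis .
  qed
  then have "(\<lambda>z. f (z i)) \<in> dual L"
    using fd i by (auto simp: dual_def linf_sum_simps linf_sum_coord)
  moreover have proj: "(\<lambda>z. z i) ` unit_ball L = unit_ball (E i)"
  proof (intro equalityI subsetI)
    fix v assume v: "v \<in> unit_ball (E i)"
    have "\<zero>\<^bsub>L\<^esub> \<in> unit_ball L" by (simp add: unit_ball_def)
    then show "v \<in> (\<lambda>z. z i) ` unit_ball L"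
      using unit_ball_update[OF _ i v] by (intro image_eqI[of _ _ "\<zero>\<^bsub>L\<^esub>(i := v)"]) auto
  qed (auto intro: unit_ball_coord i)
  have "dual_norm L (\<lambda>z. f (z i)) = dual_norm (E i) f"
    unfolding dual_norm_def proj[symmetric] image_image ..
  ultimately show ?thesis using f by (simp add: dual_sphere_def)
qed

text \<open>The point \<open>y(i := s)\<close> differs from \<open>y\<close> only in coordinate
  \<open>i\<close>. Two parameters \<open>d \<le> e\<close> are allowed because the slice of
  \<open>E i\<close> must be thinner, to compensate for \<open>x i\<close> having norm below
  one.\<close>

lemma set_dist_coord_slice_le:
  assumes y: "y \<in> unit_ball L" and i: "i \<in> \<Lambda>" and ne: "slice (E i) f d \<noteq> {}" and de: "d \<le> e"
  shows "set_dist L y (slice L (\<lambda>z. f (z i)) e) \<le> set_dist (E i) (y i) (slice (E i) f d)"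
proof (rule real_normed_space.set_dist_greatest[OF family[OF i] ne])
  fix s assume s: "s \<in> slice (E i) f d"
  then have sb: "s \<in> unit_ball (E i)" by (simp add: slice_def)
  interpret N: real_normed_space "E i" using family i .
  let ?z = "y(i := s)"
  have zb: "?z \<in> unit_ball L" by (rule unit_ball_update[OF y i sb])
  have c: "y \<in> carrier L" "?z \<in> carrier L" "s \<in> carrier (E i)"
    using y zb sb by (simp_all add: unit_ball_def)
  have "?z \<in> slice L (\<lambda>z. f (z i)) e" using zb s de by (simp add: slice_def)
  then have "set_dist L y (slice L (\<lambda>z. f (z i)) e) \<le> \<parallel>y \<ominus>\<^bsub>L\<^esub> ?z\<parallel>\<^bsub>L\<^esub>"
    using c by (intro L.set_dist_lower L.slice_subset_carrier)
  also have "\<dots> \<le> \<parallel>y i \<ominus>\<^bsub>E i\<^esub> s\<parallel>\<^bsub>E i\<^esub>"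
  proof (rule linf_sum_nrm_le)
    fix j assume j: "j \<in> \<Lambda>"
    interpret M: real_normed_space "E j" using family j .
    show "\<parallel>(y \<ominus>\<^bsub>L\<^esub> ?z) j\<parallel>\<^bsub>E j\<^esub> \<le> \<parallel>y i \<ominus>\<^bsub>E i\<^esub> s\<parallel>\<^bsub>E i\<^esub>"
      unfolding diff_coord[OF c(1,2) j]
      using c linf_sum_coord[OF c(1) j] linf_sum_coord[OF c(1) i]
      by (cases "j = i") (auto simp: a_minus_def M.r_neg)
  qed (use c linf_sum_coord[OF c(1) i] in simp)
  finally show "set_dist L y (slice L (\<lambda>z. f (z i)) e) \<le> \<parallel>y i \<ominus>\<^bsub>E i\<^esub> s\<parallel>\<^bsub>E i\<^esub>" .
qed

end

section \<open>The GL-property of the sum\<close>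

theorem proposition2p12:
  fixes \<Lambda> :: "'i set" and E :: "'i \<Rightarrow> 'a nspace"
  assumes "\<And>i. i \<in> \<Lambda> \<Longrightarrow> GL_space (E i)"
  shows "GL_space (linf_sum \<Lambda> E)"
proof -
  have banach: "real_banach_space (E i)" if "i \<in> \<Lambda>" for i
    using assms[OF that] by (simp add: GL_space_def)
  interpret normed_family \<Lambda> E
    by (rule normed_family.intro) (rule real_banach_space.axioms[OF banach])
  have "\<exists>F\<in>dual_sphere L. x \<in> slice L F e \<and>
      (\<forall>y\<in>unit_sphere L. set_dist L y (slice L F e) + set_dist L y (neg_set L (slice L F e)) < 2 + e)"
    if x: "x \<in> unit_sphere L" and e: "e > 0" for x e
  proof -
    \<comment> \<open>The bound \<open>2 * d \<le> e\<close> gives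
      \<open>(1 - d) * (1 - d) \<ge> 1 - e\<close>; the bound \<open>d < 1\<close> keeps
      \<open>1 - d\<close> positive, so that the coordinate chosen below is nonzero.\<close>
    define d where "d = min (e / 2) (1 / 2)"
    have d: "0 < d" "2 * d \<le> e" "d < 1" using e by (auto simp: d_def)
    have xc: "x \<in> carrier L" "\<parallel>x\<parallel>\<^bsub>L\<^esub> = 1" using x by (auto simp: unit_sphere_def)
    \<comment> \<open>Otherwise the supremum would be at most \<open>1 - d < 1\<close>. Since
      \<open>0 \<le> 1 - d\<close>, this excludes the empty family as well.\<close>
    obtain i where i: "i \<in> \<Lambda>" and xi: "\<parallel>x i\<parallel>\<^bsub>E i\<^esub> > 1 - d"
    proof (rule ccontr)
      assume "\<not> thesis"
      then have "\<parallel>x\<parallel>\<^bsub>L\<^esub> \<le> 1 - d"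
        using that d by (intro linf_sum_nrm_le) force+
      then show False using xc d by simp
    qed
    interpret N: real_normed_space "E i" using family i .
    let ?a = "\<parallel>x i\<parallel>\<^bsub>E i\<^esub>"
    let ?u = "(1 / ?a) \<odot>\<^bsub>E i\<^esub> x i"
    have a: "?a \<noteq> 0" using xi d by simp
    note u = N.normalize_unit_sphere[OF linf_sum_coord[OF xc(1) i] a]
    obtain f where f: "f \<in> dual_sphere (E i)" "?u \<in> slice (E i) f d"
      and ball: "\<And>v. v \<in> unit_ball (E i) \<Longrightarrow>
        set_dist (E i) v (slice (E i) f d) + set_dist (E i) (\<ominus>\<^bsub>E i\<^esub> v) (slice (E i) f d) < 2 + d"
      using GL_space_unit_ball[OF assms[OF i] u(1) d(1)] by blast
    let ?F = "\<lambda>z. f (z i)"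
    have "f (x i) = ?a * f ?u"
    proof -
      have "f (b \<odot>\<^bsub>E i\<^esub> ?u) = b * f ?u" for b
        using f(1) u(1) by (simp add: dual_sphere_def dual_def unit_sphere_def)
      then show ?thesis using u(2) by metis
    qed
    \<comment> \<open>Both factors exceed \<open>1 - d\<close>: the first by the choice of
      \<open>i\<close>, the second because \<open>?u\<close> lies in the slice of
      \<open>f\<close>.\<close>
    moreover have "(1 - d) * (1 - d) < ?a * f ?u"
      using xi f(2) d by (intro mult_strict_mono) (auto simp: slice_def)
    moreover have "1 - e \<le> (1 - d) * (1 - d)"
      using d by (simp add: algebra_simps add_increasing2)
    ultimately have "x \<in> slice L ?F e"
      using xc by (simp add: slice_def unit_ball_def)
    moreover have "set_dist L y (slice L ?F e) + set_dist L y (neg_set L (slice L ?F e)) < 2 + e"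
      if "y \<in> unit_sphere L" for y
    proof -
      have y: "y \<in> unit_ball L" "y \<in> carrier L"
        using that by (simp_all add: unit_sphere_def unit_ball_def)
      have ne: "slice (E i) f d \<noteq> {}" and de: "d \<le> e" using f d by auto
      \<comment> \<open>The negative of \<open>y\<close> is also in the ball, and its coordinate at
        \<open>i\<close> is the negative of \<open>y i\<close>, so \<open>ball\<close> controls both
        distances at once.\<close>
      have "set_dist L y (slice L ?F e) + set_dist L (\<ominus>\<^bsub>L\<^esub> y) (slice L ?F e) < 2 + d"
        using set_dist_coord_slice_le[OF y(1) i ne de]
          set_dist_coord_slice_le[OF L.unit_ball_neg[OF y(1)] i ne de]
          ball[OF unit_ball_coord[OF y(1) i]]
        unfolding neg_coord[OF y(2) i] by linarith
      then show ?thesis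
        using L.set_dist_neg_set[OF L.slice_subset_carrier y(2)] de by simp
    qed
    ultimately show ?thesis
      using coord_dual_sphere[OF f(1) i] by blast
  qed
  then show ?thesis
    using real_banach_space_L[OF banach] by (simp add: GL_space_def)
qed

end
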